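(* Let $p$ be a prime, $G$ a finite $p$-group, and $\mathcal{C}$ a $*$-covering of $G$. If $R_{\mathcal{C}}(G)$ is a simple ring, then $R_{\mathcal{C}}(G)$ is isomorphic to either $\mathbb{Z}_p$ or $M_2(\mathbb{Z}_p)$.
   Context: $\mathbb{Z}_p=\mathbb{Z}/p\mathbb{Z}$ and $M_2(\mathbb{Z}_p)$ is the ring of $2\times 2$ matrices over $\mathbb{Z}_p$. A cover of a group $G$ is a collection $\mathcal{C}$ of subgroups of $G$ with $\bigcup_{C\in\mathcal{C}}C=G$. A $*$-covering of a finite $p$-group $G$ is a cover $\mathcal{C}$ each of whose members is either a maximal cyclic subgroup of $G$ (a cyclic subgroup not properly contained in another cyclic subgroup of $G$) or an elementary abelian subgroup of order $p^2$. For a cover $\mathcal{C}$ by abelian subgroups, $R_{\mathcal{C}}(G)=\{f:G\to G \mid f|_C\in \mathrm{End}(C)\text{ for each }C\in\mathcal{C}\}$, where $f|_C\in\mathrm{End}(C)$ means that $f$ maps $C$ into $C$ and is a homomorphism on $C$. It is a ring under pointwise addition (using the group operation of $G$) and composition of functions. *)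

theory Defs
  imports "HOL-Number_Theory.Residues" "HOL-Algebra.Elementary_Groups" "HOL-Algebra.RingHom"
    "HOL-Algebra.QuotRing" "Jordan_Normal_Form.Matrix"
begin

definition group_cover :: "'a monoid \<Rightarrow> 'a set set \<Rightarrow> bool" where
  "group_cover G \<C> \<longleftrightarrow> (\<forall>C\<in>\<C>. subgroup C G) \<and> \<Union>\<C> = carrier G"

definition cyclic_subgroup :: "'a set \<Rightarrow> 'a monoid \<Rightarrow> bool" where
  "cyclic_subgroup C G \<longleftrightarrow> subgroup C G \<and> cyclic_group (G\<lparr>carrier := C\<rparr>)"

definition maximal_cyclic_subgroup :: "'a set \<Rightarrow> 'a monoid \<Rightarrow> bool" where
  "maximal_cyclic_subgroup C G \<longleftrightarrow>
     cyclic_subgroup C G \<and> \<not> (\<exists>D. cyclic_subgroup D G \<and> C \<subset> D)"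

definition elementary_abelian_group :: "nat \<Rightarrow> 'a monoid \<Rightarrow> bool" where
  "elementary_abelian_group p H \<longleftrightarrow>
     comm_group H \<and> (\<forall>x\<in>carrier H. x [^]\<^bsub>H\<^esub> p = \<one>\<^bsub>H\<^esub>)"

definition star_covering :: "nat \<Rightarrow> 'a monoid \<Rightarrow> 'a set set \<Rightarrow> bool" where
  "star_covering p G \<C> \<longleftrightarrow> group_cover G \<C> \<and>
     (\<forall>C\<in>\<C>. maximal_cyclic_subgroup C G \<or>
        (subgroup C G \<and> elementary_abelian_group p (G\<lparr>carrier := C\<rparr>) \<and> card C = p ^ 2))"

text \<open>Functions from \<open>G\<close> to \<open>G\<close> are represented by extensional functions on
  \<open>carrier G\<close>, so that equality of ring elements is equality on \<open>G\<close>.\<close>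

definition cover_ring :: "'a monoid \<Rightarrow> 'a set set \<Rightarrow> ('a \<Rightarrow> 'a) ring" where
  "cover_ring G \<C> =
     \<lparr>carrier = {f \<in> carrier G \<rightarrow>\<^sub>E carrier G.
                   \<forall>C\<in>\<C>. f \<in> hom (G\<lparr>carrier := C\<rparr>) (G\<lparr>carrier := C\<rparr>)},
      monoid.mult = (\<lambda>f g. compose (carrier G) f g),
      one = (\<lambda>x\<in>carrier G. x),
      zero = (\<lambda>x\<in>carrier G. \<one>\<^bsub>G\<^esub>),
      add = (\<lambda>f g. \<lambda>x\<in>carrier G. f x \<otimes>\<^bsub>G\<^esub> g x)\<rparr>"

locale simple_ring = ring +
  assumes not_zero_ring: "carrier R \<noteq> {\<zero>}"
    and ideal_trivial: "ideal I R \<Longrightarrow> I = {\<zero>} \<or> I = carrier R"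

definition matrix_ring :: "nat \<Rightarrow> 'a ring \<Rightarrow> 'a mat ring" where
  "matrix_ring n R =
     \<lparr>carrier = {A \<in> carrier_mat n n. \<forall>i<n. \<forall>j<n. A $$ (i, j) \<in> carrier R},
      monoid.mult = (\<lambda>A B. mat n n (\<lambda>(i, j). \<Oplus>\<^bsub>R\<^esub>k\<in>{..<n}. A $$ (i, k) \<otimes>\<^bsub>R\<^esub> B $$ (k, j))),
      one = mat n n (\<lambda>(i, j). if i = j then \<one>\<^bsub>R\<^esub> else \<zero>\<^bsub>R\<^esub>),
      zero = mat n n (\<lambda>(i, j). \<zero>\<^bsub>R\<^esub>),
      add = (\<lambda>A B. mat n n (\<lambda>(i, j). A $$ (i, j) \<oplus>\<^bsub>R\<^esub> B $$ (i, j)))\<rparr>"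

lemma ring_cover_ring:
  assumes G: "group G" and cov: "group_cover G \<C>"
    and ab: "\<And>C. C \<in> \<C> \<Longrightarrow> comm_group (G\<lparr>carrier := C\<rparr>)"
  shows "ring (cover_ring G \<C>)"
proof -
  interpret G: group G by (fact G)
  have sub: "subgroup C G" if "C \<in> \<C>" for C
    using cov that by (auto simp: group_cover_def)
  have sub_mem: "x \<in> carrier G" if "C \<in> \<C>" "x \<in> C" for C x
    using sub[OF that(1)] that(2) by (rule subgroup.mem_carrier)
  have cover: "\<exists>C\<in>\<C>. x \<in> C" if "x \<in> carrier G" for x
    using cov that by (auto simp: group_cover_def)
  have comm: "x \<otimes>\<^bsub>G\<^esub> y = y \<otimes>\<^bsub>G\<^esub> x" if "C \<in> \<C>" "x \<in> C" "y \<in> C" for C x y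
    using comm_monoid.m_comm[OF comm_group.axioms(1)[OF ab[OF that(1)]], of x y] that by simp
  let ?R = "cover_ring G \<C>"
  have iff: "f \<in> carrier ?R \<longleftrightarrow> f \<in> extensional (carrier G) \<and>
      (\<forall>C\<in>\<C>. (\<forall>x\<in>C. f x \<in> C) \<and> (\<forall>x\<in>C. \<forall>y\<in>C. f (x \<otimes>\<^bsub>G\<^esub> y) = f x \<otimes>\<^bsub>G\<^esub> f y))" for f
  proof -
    have "f \<in> carrier G \<rightarrow> carrier G" if "\<forall>C\<in>\<C>. \<forall>x\<in>C. f x \<in> C"
      using that cover sub_mem by blast
    then show ?thesis
      by (auto simp: cover_ring_def hom_def PiE_def Pi_def)
  qed
  have pres: "f x \<in> C" if "f \<in> carrier ?R" "C \<in> \<C>" "x \<in> C" for f C x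
    using that iff by blast
  have homo: "f (x \<otimes>\<^bsub>G\<^esub> y) = f x \<otimes>\<^bsub>G\<^esub> f y"
    if "f \<in> carrier ?R" "C \<in> \<C>" "x \<in> C" "y \<in> C" for f C x y
    using that iff by blast
  have clo: "f x \<in> carrier G" if "f \<in> carrier ?R" "x \<in> carrier G" for f x
    using pres cover sub_mem that by blast
  have ext: "f = g" if "f \<in> extensional (carrier G)" "g \<in> extensional (carrier G)"
    "\<And>x. x \<in> carrier G \<Longrightarrow> f x = g x" for f g :: "'a \<Rightarrow> 'a"
    using that by (rule extensionalityI)
  have R_ext: "f \<in> extensional (carrier G)" if "f \<in> carrier ?R" for f
    using that iff by blast
  have add: "f \<oplus>\<^bsub>?R\<^esub> g = (\<lambda>x\<in>carrier G. f x \<otimes>\<^bsub>G\<^esub> g x)" for f g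
    by (simp add: cover_ring_def)
  have mul: "f \<otimes>\<^bsub>?R\<^esub> g = (\<lambda>x\<in>carrier G. f (g x))" for f g
    by (simp add: cover_ring_def compose_def)
  have one: "\<one>\<^bsub>?R\<^esub> = (\<lambda>x\<in>carrier G. x)" and zero: "\<zero>\<^bsub>?R\<^esub> = (\<lambda>x\<in>carrier G. \<one>\<^bsub>G\<^esub>)"
    by (simp_all add: cover_ring_def)
  have mC: "x \<otimes>\<^bsub>G\<^esub> y \<in> C" if "C \<in> \<C>" "x \<in> C" "y \<in> C" for C x y
    using subgroup.m_closed[OF sub[OF that(1)]] that by blast
  have oC: "\<one>\<^bsub>G\<^esub> \<in> C" if "C \<in> \<C>" for C
    using subgroup.one_closed[OF sub[OF that(1)]] .
  have iC: "inv\<^bsub>G\<^esub> x \<in> C" if "C \<in> \<C>" "x \<in> C" for C x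
    using subgroup.m_inv_closed[OF sub[OF that(1)]] that by blast
  have swap: "(a \<otimes>\<^bsub>G\<^esub> b) \<otimes>\<^bsub>G\<^esub> (c \<otimes>\<^bsub>G\<^esub> d) = (a \<otimes>\<^bsub>G\<^esub> c) \<otimes>\<^bsub>G\<^esub> (b \<otimes>\<^bsub>G\<^esub> d)"
    if "C \<in> \<C>" "a \<in> C" "b \<in> C" "c \<in> C" "d \<in> C" for C a b c d
  proof -
    note [simp] = that(2-5)[THEN sub_mem[OF that(1)]]
    have "(a \<otimes>\<^bsub>G\<^esub> b) \<otimes>\<^bsub>G\<^esub> (c \<otimes>\<^bsub>G\<^esub> d) = a \<otimes>\<^bsub>G\<^esub> (b \<otimes>\<^bsub>G\<^esub> c) \<otimes>\<^bsub>G\<^esub> d"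
      by (simp add: G.m_assoc)
    also have "b \<otimes>\<^bsub>G\<^esub> c = c \<otimes>\<^bsub>G\<^esub> b"
      using comm that by blast
    finally show ?thesis by (simp add: G.m_assoc)
  qed
  have addc: "f \<oplus>\<^bsub>?R\<^esub> g \<in> carrier ?R" if f: "f \<in> carrier ?R" and g: "g \<in> carrier ?R" for f g
    unfolding iff add
    using swap pres[OF f] pres[OF g] homo[OF f] homo[OF g] mC sub_mem by auto
  have mulc: "f \<otimes>\<^bsub>?R\<^esub> g \<in> carrier ?R" if f: "f \<in> carrier ?R" and g: "g \<in> carrier ?R" for f g
    unfolding iff mul
    using pres[OF f] pres[OF g] homo[OF f] homo[OF g] mC sub_mem by auto
  have onec: "\<one>\<^bsub>?R\<^esub> \<in> carrier ?R"
    unfolding iff one using mC sub_mem by auto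
  have zeroc: "\<zero>\<^bsub>?R\<^esub> \<in> carrier ?R"
    unfolding iff zero using mC oC sub_mem by auto
  have invc: "(\<lambda>x\<in>carrier G. inv\<^bsub>G\<^esub> (f x)) \<in> carrier ?R" if f: "f \<in> carrier ?R" for f
    unfolding iff
  proof (intro conjI ballI)
    fix C x y assume C: "C \<in> \<C>" "x \<in> C" "y \<in> C"
    have "f (x \<otimes>\<^bsub>G\<^esub> y) = f y \<otimes>\<^bsub>G\<^esub> f x"
      using homo[OF f C] comm[OF C(1) pres[OF f C(1,2)] pres[OF f C(1,3)]] by simp
    then show "(\<lambda>x\<in>carrier G. inv\<^bsub>G\<^esub> (f x)) (x \<otimes>\<^bsub>G\<^esub> y) =
        (\<lambda>x\<in>carrier G. inv\<^bsub>G\<^esub> (f x)) x \<otimes>\<^bsub>G\<^esub> (\<lambda>x\<in>carrier G. inv\<^bsub>G\<^esub> (f x)) y"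
      using C sub_mem mC clo[OF f] by (simp add: G.inv_mult_group)
  qed (use iC pres[OF f] sub_mem in auto)
  show ?thesis
  proof (rule ringI)
    show "abelian_group ?R"
    proof (rule abelian_groupI)
      fix f assume f: "f \<in> carrier ?R"
      show "\<exists>g\<in>carrier ?R. g \<oplus>\<^bsub>?R\<^esub> f = \<zero>\<^bsub>?R\<^esub>"
        using invc[OF f] clo[OF f] by (intro bexI) (auto simp: add zero)
      show "\<zero>\<^bsub>?R\<^esub> \<oplus>\<^bsub>?R\<^esub> f = f"
        by (rule ext) (auto simp: add zero R_ext f clo)
      fix g assume g: "g \<in> carrier ?R"
      have "f x \<otimes>\<^bsub>G\<^esub> g x = g x \<otimes>\<^bsub>G\<^esub> f x" if "x \<in> carrier G" for x
        using cover[OF that] comm pres[OF f] pres[OF g] by blast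
      then show "f \<oplus>\<^bsub>?R\<^esub> g = g \<oplus>\<^bsub>?R\<^esub> f"
        by (auto simp: add)
      fix h assume h: "h \<in> carrier ?R"
      show "(f \<oplus>\<^bsub>?R\<^esub> g) \<oplus>\<^bsub>?R\<^esub> h = f \<oplus>\<^bsub>?R\<^esub> (g \<oplus>\<^bsub>?R\<^esub> h)"
        by (rule ext) (auto simp: add f g h clo G.m_assoc)
    qed (use addc zeroc in auto)
    show "monoid ?R"
      by (rule monoidI) (use mulc onec in \<open>auto simp: mul one clo R_ext intro!: ext\<close>)
    fix f g h assume f: "f \<in> carrier ?R" and g: "g \<in> carrier ?R" and h: "h \<in> carrier ?R"
    show "(f \<oplus>\<^bsub>?R\<^esub> g) \<otimes>\<^bsub>?R\<^esub> h = f \<otimes>\<^bsub>?R\<^esub> h \<oplus>\<^bsub>?R\<^esub> g \<otimes>\<^bsub>?R\<^esub> h"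
      by (rule ext) (auto simp: add mul f g h clo)
    have "h (f x \<otimes>\<^bsub>G\<^esub> g x) = h (f x) \<otimes>\<^bsub>G\<^esub> h (g x)" if "x \<in> carrier G" for x
      using cover[OF that] homo[OF h] pres[OF f] pres[OF g] by blast
    then show "h \<otimes>\<^bsub>?R\<^esub> (f \<oplus>\<^bsub>?R\<^esub> g) = h \<otimes>\<^bsub>?R\<^esub> f \<oplus>\<^bsub>?R\<^esub> h \<otimes>\<^bsub>?R\<^esub> g"
      by (auto simp: add mul intro!: ext)
  qed
qed

end

theory Submission
  imports Defs
begin

text \<open>
  Let $R$ be simple. If $p^m$ is the exponent of $G$, the functions with values of exponent $p$ form
  an ideal that contains the nonzero function $x \mapsto x^{p^{m-1}}$, hence also the identity;
  so $G$ has exponent $p$. If some $x \neq 1$ is mapped by every function in $R$ to a power of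
  itself, then the exponent modulo $p$ is a ring homomorphism onto $\mathbf{Z}_p$, injective by
  simplicity. Every nontrivial element of a cyclic member of the cover, and every nontrivial element
  of two distinct members of order $p^2$, is such an $x$. If there is none, the cover is therefore a
  partition into groups of order $p^2$, and the projection onto one of them generates the ideal of
  functions trivial outside it. By simplicity this member is $G$, and $R$ is its endomorphism ring.
\<close>

section \<open>A criterion for ideals\<close>

text \<open>Negatives come from absorption, since the negative of \<open>a\<close> is the product of
  the negative of \<open>\<one>\<close> with \<open>a\<close>.\<close>

lemma (in ring) idealI_closed:
  assumes "I \<subseteq> carrier R" "\<zero> \<in> I"
    and add: "\<And>a b. a \<in> I \<Longrightarrow> b \<in> I \<Longrightarrow> a \<oplus> b \<in> I"
    and l: "\<And>a x. a \<in> I \<Longrightarrow> x \<in> carrier R \<Longrightarrow> x \<otimes> a \<in> I"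
    and r: "\<And>a x. a \<in> I \<Longrightarrow> x \<in> carrier R \<Longrightarrow> a \<otimes> x \<in> I"
  shows "ideal I R"
proof (rule idealI[OF ring_axioms _ l r])
  have "\<ominus> a \<in> I" if "a \<in> I" for a
  proof -
    have "\<ominus> a = \<ominus> \<one> \<otimes> a"
      using that assms(1) by (auto simp: l_minus)
    then show ?thesis
      using l[OF that, of "\<ominus> \<one>"] by simp
  qed
  then show "subgroup I (add_monoid R)"
    using assms by (intro subgroup.intro) (auto simp: a_inv_def)
qed

section \<open>Powers in groups of prime exponent\<close>

text \<open>The order of \<open>x\<close> divides the prime \<open>p\<close> and is not 1, so it
  equals \<open>p\<close>.\<close>

lemma (in group) int_pow_eq_iff_cong:
  assumes "Factorial_Ring.prime p" "x \<in> carrier G" "x [^] (p::nat) = \<one>" "x \<noteq> \<one>"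
  shows "x [^] (i::int) = x [^] j \<longleftrightarrow> [i = j] (mod int p)"
proof -
  have "ord x dvd p"
    using assms by (simp add: pow_eq_id)
  moreover have "ord x \<noteq> 1"
    using assms ord_eq_1 by blast
  ultimately have "ord x = p"
    using assms(1) by (auto simp: prime_nat_iff)
  then show ?thesis
    using int_pow_eq[OF assms(2), of i j] by (simp add: cong_iff_dvd_diff dvd_diff_commute)
qed

lemma (in group) int_pow_mod:
  assumes "x \<in> carrier G" "x [^] (p::nat) = \<one>"
  shows "x [^] (i mod int p) = x [^] i"
proof -
  have "ord x dvd p"
    using assms by (simp add: pow_eq_id)
  then have "int (ord x) dvd (i - i mod int p)"
    by (meson dvd_minus_mod dvd_trans int_dvd_int_iff)
  then show ?thesis
    using assms by (simp add: int_pow_eq)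
qed

text \<open>The witness \<open>u\<close> is an inverse of \<open>d\<close> modulo \<open>p\<close>:
  a power of \<open>b\<close> with exponent prime to \<open>p\<close> generates the same subgroup as
  \<open>b\<close>.\<close>

lemma (in group) mem_range_int_pow:
  assumes "Factorial_Ring.prime p" "b \<in> carrier G" "b [^] (p::nat) = \<one>" "\<not> int p dvd d"
  obtains u :: int where "b = (b [^] d) [^] u"
proof -
  have "coprime d (int p)"
    using assms(1,4) by (metis coprime_commute prime_imp_coprime prime_nat_int_transfer)
  then obtain u where "[d * u = 1] (mod int p)"
    using cong_solve_coprime_int by blast
  then have "(d * u) mod int p = 1 mod int p"
    by (simp add: cong_def)
  then have "b [^] (d * u) = b [^] (1::int)"
    using int_pow_mod[OF assms(2,3), of "d * u"] int_pow_mod[OF assms(2,3), of 1] by simp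
  then show thesis
    using that[of u] assms(2) by (simp add: int_pow_pow)
qed

text \<open>In additive language, \<open>C\<close> is a plane over the field with \<open>p\<close>
  elements and \<open>a\<close>, \<open>b\<close> are linearly independent in it. Independence gives
  injectivity, and counting gives surjectivity.\<close>

lemma (in group) bij_betw_basis:
  fixes p :: nat
  assumes p: "Factorial_Ring.prime p" and C: "subgroup C G"
    and pow: "\<And>x. x \<in> C \<Longrightarrow> x [^] p = \<one>" and card: "card C = p ^ 2"
    and a: "a \<in> C" "a \<noteq> \<one>" and b: "b \<in> C" "\<And>k::int. b \<noteq> a [^] k"
  shows "bij_betw (\<lambda>(i::int, j::int). a [^] i \<otimes> b [^] j) ({0..int p - 1} \<times> {0..int p - 1}) C"
    (is "bij_betw ?m ?P C")
proof -
  have car [simp]: "a \<in> carrier G" "b \<in> carrier G"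
    using a b subgroup.mem_carrier[OF C] by auto
  have "inj_on ?m ?P"
  proof (rule inj_onI, clarify)
    fix i j i' j' :: int
    assume r: "i \<in> {0..int p - 1}" "j \<in> {0..int p - 1}" "i' \<in> {0..int p - 1}" "j' \<in> {0..int p - 1}"
      and eq: "a [^] i \<otimes> b [^] j = a [^] i' \<otimes> b [^] j'"
    \<comment> \<open>Cancelling a power of \<open>a\<close> on the left and a power of
      \<open>b\<close> on the right isolates a power of \<open>b\<close> that is a power of
      \<open>a\<close>.\<close>
    have "b [^] (j - j') = a [^] (- i) \<otimes> (a [^] i \<otimes> b [^] j) \<otimes> b [^] (- j')"
      using int_pow_mult[of a "- i" i] int_pow_mult[of b j "- j'"] by (simp flip: m_assoc)
    also have "\<dots> = a [^] (i' - i)"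
      unfolding eq using int_pow_mult[of a "- i" i'] int_pow_mult[of b j' "- j'"]
      by (simp add: m_assoc)
    finally have *: "b [^] (j - j') = a [^] (i' - i)" .
    \<comment> \<open>Otherwise the exponent is invertible modulo \<open>p\<close>, and
      \<open>b\<close> itself would be a power of \<open>a\<close>.\<close>
    have "int p dvd (j - j')"
    proof (rule ccontr)
      assume "\<not> int p dvd (j - j')"
      then obtain u :: int where "b = (b [^] (j - j')) [^] u"
        using mem_range_int_pow[OF p, of b] pow b by auto
      then show False
        using b(2)[of "(i' - i) * u"] * by (simp add: int_pow_pow)
    qed
    then have "[j = j'] (mod int p)"
      by (simp add: cong_iff_dvd_diff)
    then have jj: "j = j'"
      using r by (auto simp: cong_def)
    then have "a [^] i = a [^] i'"
      using eq by simp
    then have "[i = i'] (mod int p)"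
      using int_pow_eq_iff_cong[OF p] a pow by simp
    then show "i = i' \<and> j = j'"
      using jj r by (auto simp: cong_def)
  qed
  moreover have "?m ` ?P \<subseteq> C"
    using subgroup_int_pow_closed[OF C a(1)] subgroup_int_pow_closed[OF C b(1)]
    by (auto intro!: subgroup.m_closed[OF C])
  moreover have "card ?P = card C"
    by (simp add: card power2_eq_square)
  moreover have "finite C"
    using card p by (metis card.infinite prime_gt_0_nat zero_less_power less_numeral_extra(3))
  ultimately show ?thesis
    unfolding bij_betw_def using card_image[of ?m ?P] card_subset_eq[of C "?m ` ?P"] by simp
qed

section \<open>The ring of a star covering\<close>

locale star_covered_group = group G for G :: "'a monoid" (structure) +
  fixes p :: nat and \<C> :: "'a set set"
  assumes prime: "Factorial_Ring.prime p" and star: "star_covering p G \<C>"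
begin

abbreviation "R \<equiv> cover_ring G \<C>"

lemma subgroup_cover: "C \<in> \<C> \<Longrightarrow> subgroup C G"
  using star unfolding star_covering_def group_cover_def by blast

lemma cover_mem_carrier: "C \<in> \<C> \<Longrightarrow> x \<in> C \<Longrightarrow> x \<in> carrier G"
  by (rule subgroup.mem_carrier[OF subgroup_cover])

lemma cover_obtain:
  assumes "x \<in> carrier G" obtains C where "C \<in> \<C>" "x \<in> C"
  using assms star unfolding star_covering_def group_cover_def by blast

text \<open>Cyclic groups are abelian, and the other members are so by definition. This makes
  pointwise sums homomorphisms on each member, so that \<open>R\<close> is a ring.\<close>

lemma comm_group_cover:
  assumes "C \<in> \<C>" shows "comm_group (G\<lparr>carrier := C\<rparr>)"
proof -
  have "cyclic_group (G\<lparr>carrier := C\<rparr>) \<or> comm_group (G\<lparr>carrier := C\<rparr>)"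
    using star assms unfolding star_covering_def maximal_cyclic_subgroup_def cyclic_subgroup_def
      elementary_abelian_group_def by blast
  then show ?thesis
    using group.cyclic_imp_abelian_group[OF subgroup.subgroup_is_group[OF subgroup_cover[OF assms] is_group]]
    by blast
qed

lemma comm_cover:
  assumes "C \<in> \<C>" "x \<in> C" "y \<in> C" shows "x \<otimes> y = y \<otimes> x"
  using comm_monoid.m_comm[OF comm_group.axioms(1)[OF comm_group_cover[OF assms(1)]], of x y]
    assms by simp

sublocale R: ring R
proof (rule ring_cover_ring[OF is_group _ comm_group_cover])
  show "group_cover G \<C>"
    using star by (simp add: star_covering_def)
qed

text \<open>That \<open>f\<close> maps \<open>G\<close> into \<open>G\<close> follows from its
  mapping each member into itself, because the members cover \<open>G\<close>.\<close>

lemma mem_cover_ring: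
  "f \<in> carrier R \<longleftrightarrow> f \<in> extensional (carrier G) \<and>
     (\<forall>C\<in>\<C>. (\<forall>x\<in>C. f x \<in> C) \<and> (\<forall>x\<in>C. \<forall>y\<in>C. f (x \<otimes> y) = f x \<otimes> f y))"
proof -
  have "f \<in> carrier G \<rightarrow> carrier G" if "\<forall>C\<in>\<C>. \<forall>x\<in>C. f x \<in> C"
  proof
    fix x assume "x \<in> carrier G"
    then obtain C where "C \<in> \<C>" "x \<in> C"
      by (rule cover_obtain)
    with that show "f x \<in> carrier G"
      using cover_mem_carrier[of C "f x"] by blast
  qed
  then show ?thesis
    by (auto simp: cover_ring_def hom_def PiE_def Pi_def)
qed

lemma cover_ring_closed [simp]: "f \<in> carrier R \<Longrightarrow> x \<in> carrier G \<Longrightarrow> f x \<in> carrier G"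
  by (auto simp: cover_ring_def)

lemma cover_ring_ops [simp]:
  "x \<in> carrier G \<Longrightarrow> (f \<oplus>\<^bsub>R\<^esub> g) x = f x \<otimes> g x"
  "x \<in> carrier G \<Longrightarrow> (f \<otimes>\<^bsub>R\<^esub> g) x = f (g x)"
  "x \<in> carrier G \<Longrightarrow> \<one>\<^bsub>R\<^esub> x = x"
  "x \<in> carrier G \<Longrightarrow> \<zero>\<^bsub>R\<^esub> x = \<one>"
  by (simp_all add: cover_ring_def compose_def)

lemma cover_ring_eqI:
  assumes "f \<in> carrier R" "g \<in> carrier R" "\<And>x. x \<in> carrier G \<Longrightarrow> f x = g x"
  shows "f = g"
  using assms by (intro extensionalityI[of f "carrier G" g]) (auto simp: mem_cover_ring)

text \<open>An element of \<open>R\<close> need not be a homomorphism on \<open>G\<close>, but all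
  powers of \<open>x\<close> lie in one member containing \<open>x\<close>, where it is one.\<close>

lemma cover_ring_int_pow:
  assumes f: "f \<in> carrier R" and x: "x \<in> carrier G"
  shows "f (x [^] (k::int)) = f x [^] k"
proof -
  obtain C where C: "C \<in> \<C>" "x \<in> C"
    using x cover_obtain by blast
  have gr: "group (G\<lparr>carrier := C\<rparr>)"
    using subgroup.subgroup_is_group[OF subgroup_cover[OF C(1)] is_group] .
  have "f \<in> hom (G\<lparr>carrier := C\<rparr>) (G\<lparr>carrier := C\<rparr>)"
    using f C by (auto simp: cover_ring_def)
  from hom_int_pow[OF this _ gr gr, of x k] C f show ?thesis
    using int_pow_consistent[OF subgroup_cover[OF C(1)]] by (simp add: mem_cover_ring)
qed

lemma cover_ring_nat_pow:
  "f \<in> carrier R \<Longrightarrow> x \<in> carrier G \<Longrightarrow> f (x [^] (k::nat)) = f x [^] k"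
  using cover_ring_int_pow[of f x "int k"] by (simp add: int_pow_int)

lemma cover_ring_apply_one [simp]: "f \<in> carrier R \<Longrightarrow> f \<one> = \<one>"
  using cover_ring_int_pow[of f \<one> 0] by simp

text \<open>Taking powers is a homomorphism on each member, because members are abelian. These maps
  are the integer multiples of the identity of \<open>R\<close>.\<close>

lemma int_pow_mem_cover_ring: "(\<lambda>x\<in>carrier G. x [^] (k::int)) \<in> carrier R"
  unfolding mem_cover_ring
proof (intro conjI ballI)
  fix C x y assume C: "C \<in> \<C>" "x \<in> C" "y \<in> C"
  then have "x \<otimes> y \<in> carrier G" "(x \<otimes> y) [^] k = x [^] k \<otimes> y [^] k"
    using int_pow_mult_distrib[OF comm_cover[OF C]] cover_mem_carrier by auto
  then show "(\<lambda>x\<in>carrier G. x [^] k) (x \<otimes> y) =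
      (\<lambda>x\<in>carrier G. x [^] k) x \<otimes> (\<lambda>x\<in>carrier G. x [^] k) y"
    using C cover_mem_carrier by simp
qed (use subgroup_int_pow_closed subgroup_cover cover_mem_carrier in auto)

section \<open>Endomorphisms of an elementary abelian group of order p^2\<close>

text \<open>Here \<open>R\<close> consists of all endomorphisms of \<open>G\<close>: the whole group
  is a member, and a trivial member only asks that \<open>\<one>\<close> be fixed. A choice of basis
  turns endomorphisms into matrices.\<close>

lemma iso_matrix_ring:
  assumes card: "order G = p ^ 2" and pow: "\<And>x. x \<in> carrier G \<Longrightarrow> x [^] p = \<one>"
    and GC: "carrier G \<in> \<C>" and triv: "\<And>C. C \<in> \<C> \<Longrightarrow> C = carrier G \<or> C = {\<one>}"
  shows "R \<simeq> matrix_ring 2 (residue_ring (int p))"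
proof -
  have p1: "int p > 1" "p > 1"
    using prime prime_gt_1_nat by auto
  have comm: "x \<otimes> y = y \<otimes> x" if "x \<in> carrier G" "y \<in> carrier G" for x y
    using comm_cover[OF GC that] .
  have pp: "1 < p ^ 2" "p < p ^ 2"
    using one_less_power[OF p1(2), of 2] power_strict_increasing[of 1 2 p] p1 by simp_all
  have "carrier G \<noteq> {\<one>}"
    using card pp by (auto simp: order_def)
  then obtain a where a: "a \<in> carrier G" "a \<noteq> \<one>"
    using one_closed by blast
  \<comment> \<open>The powers of \<open>a\<close> number at most \<open>p\<close>, fewer than
    \<open>p ^ 2\<close>, so a second basis element \<open>b\<close> can be taken outside
    them.\<close>
  have "range (\<lambda>k::int. a [^] k) \<subseteq> (\<lambda>k. a [^] k) ` {0..<int p}"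
  proof clarify
    fix k :: int
    have "a [^] k = a [^] (k mod int p)" "k mod int p \<in> {0..<int p}"
      using int_pow_mod[OF a(1) pow[OF a(1)]] p1 by auto
    then show "a [^] k \<in> (\<lambda>k. a [^] k) ` {0..<int p}"
      by blast
  qed
  then have "card (range (\<lambda>k::int. a [^] k)) \<le> card {0..<int p}"
    by (meson surj_card_le finite_atLeastLessThan_int)
  then have "range (\<lambda>k::int. a [^] k) \<noteq> carrier G"
    using pp card by (auto simp: order_def)
  moreover have "range (\<lambda>k::int. a [^] k) \<subseteq> carrier G"
    using a by auto
  ultimately obtain b where b: "b \<in> carrier G" "\<And>k::int. b \<noteq> a [^] k"
    by blast
  \<comment> \<open>The exponents range over all integers, so that products and powers act on them
    without reduction modulo \<open>p\<close>.\<close>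
  define m where "m i j = a [^] i \<otimes> b [^] j" for i j :: int
  let ?P = "{0..int p - 1} \<times> {0..int p - 1}"
  have bij: "bij_betw (\<lambda>(i, j). m i j) ?P (carrier G)"
    unfolding m_def using bij_betw_basis[OF prime subgroup_self pow _ a b] card
    by (simp add: order_def)
  have m_closed: "m i j \<in> carrier G" for i j
    using a b by (simp add: m_def)
  have m_mod: "m (i mod int p) (j mod int p) = m i j" for i j
    using a b pow by (simp add: m_def int_pow_mod)
  have m_cong: "m i j = m i' j'" if "i mod int p = i' mod int p" "j mod int p = j' mod int p" for i j i' j'
    using m_mod[of i j] m_mod[of i' j'] that by simp
  have m_mult: "m i j \<otimes> m i' j' = m (i + i') (j + j')" for i j i' j'
  proof -
    have "m i j \<otimes> m i' j' = a [^] i \<otimes> (b [^] j \<otimes> a [^] i') \<otimes> b [^] j'"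
      using a b by (simp add: m_def m_assoc)
    also have "\<dots> = a [^] i \<otimes> (a [^] i' \<otimes> b [^] j) \<otimes> b [^] j'"
      using a b comm[of "b [^] j" "a [^] i'"] by simp
    also have "\<dots> = m (i + i') (j + j')"
      using a b by (simp add: m_def m_assoc int_pow_mult)
    finally show ?thesis .
  qed
  have m_pow: "m i j [^] k = m (i * k) (j * k)" for i j k :: int
    using a b int_pow_mult_distrib[OF comm, of "a [^] i" "b [^] j" k]
    by (simp add: m_def int_pow_pow)
  \<comment> \<open>\<open>c' 0 x\<close> and \<open>c' 1 x\<close> are the exponents of \<open>x\<close> with respect to the basis \<open>a, b\<close>.\<close>
  define c where "c x = inv_into ?P (\<lambda>(i, j). m i j) x" for x
  define c' where "c' i x = (if i = (0::nat) then fst (c x) else snd (c x))" for i x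
  have c: "c x \<in> ?P" "m (c' 0 x) (c' 1 x) = x" if "x \<in> carrier G" for x
    using inv_into_into[of x "\<lambda>(i, j). m i j" ?P] f_inv_into_f[of x "\<lambda>(i, j). m i j" ?P] that bij
    unfolding c_def[symmetric] c'_def by (auto simp: bij_betw_def case_prod_beta)
  have c'_range: "c' i x \<in> {0..int p - 1}" if "x \<in> carrier G" for i x
    using c(1)[OF that] by (auto simp: c'_def mem_Times_iff)
  have c'_m: "c' i (m j k) = (if i = 0 then j mod int p else k mod int p)" for i j k
  proof -
    have "(j mod int p, k mod int p) \<in> ?P"
      using p1 by simp
    from inv_into_f_f[OF bij_betw_imp_inj_on[OF bij] this] show ?thesis
      by (simp add: c'_def c_def m_mod)
  qed
  define e where "e j = (if j = (0::nat) then a else b)" for j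
  have e: "e j \<in> carrier G" "e j = m (if j = 0 then 1 else 0) (if j = 0 then 0 else 1)" for j
    using a b by (auto simp: e_def m_def)
  \<comment> \<open>In coordinates, \<open>f\<close> acts by the matrix whose columns are the
    coordinates of \<open>f (e 0)\<close> and \<open>f (e 1)\<close>.\<close>
  have apply_m: "f (m i j) = m (c' 0 (f (e 0)) * i + c' 0 (f (e 1)) * j) (c' 1 (f (e 0)) * i + c' 1 (f (e 1)) * j)"
    if f: "f \<in> carrier R" for f i j
  proof -
    have "f (m i j) = f (a [^] i) \<otimes> f (b [^] j)"
      using f GC a b unfolding m_def by (simp add: mem_cover_ring)
    also have "\<dots> = f (e 0) [^] i \<otimes> f (e 1) [^] j"
      using cover_ring_int_pow[OF f] a b by (simp add: e_def)
    also have "\<dots> = m (c' 0 (f (e 0))) (c' 1 (f (e 0))) [^] i \<otimes> m (c' 0 (f (e 1))) (c' 1 (f (e 1))) [^] j"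
      using c(2)[OF cover_ring_closed[OF f e(1)]] by simp
    finally show ?thesis
      by (simp only: m_pow m_mult)
  qed
  interpret Z: residues "int p" "residue_ring (int p)"
    by unfold_locales (use p1 in auto)
  have Z_carrier: "x \<in> carrier (residue_ring (int p)) \<longleftrightarrow> x \<in> {0..int p - 1}" for x
    by (simp add: Z.res_carrier_eq)
  have Z_sum: "(\<Oplus>\<^bsub>residue_ring (int p)\<^esub>k\<in>{..<2::nat}. g k) = (g 0 + g 1) mod int p"
    if "g 0 \<in> {0..int p - 1}" "g 1 \<in> {0..int p - 1}" for g
  proof -
    have "{..<2::nat} = {0, 1}"
      by auto
    then show ?thesis
      using that by (simp add: Z_carrier Z.res_add_eq Z.res_zero_eq mod_simps Pi_def)
  qed
  \<comment> \<open>Column \<open>j\<close> holds the coordinates of the image of the basis element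
    \<open>e j\<close>; with this convention composition becomes the matrix product in the same
    order.\<close>
  define h where "h f = mat 2 2 (\<lambda>(i, j). c' i (f (e j)))" for f
  have "h \<in> ring_iso R (matrix_ring 2 (residue_ring (int p)))"
  proof (rule ring_iso_memI)
    fix f assume f: "f \<in> carrier R"
    show "h f \<in> carrier (matrix_ring 2 (residue_ring (int p)))"
      using c'_range cover_ring_closed[OF f e(1)] by (simp add: h_def matrix_ring_def Z_carrier)
    fix g assume g: "g \<in> carrier R"
    show "h (f \<oplus>\<^bsub>R\<^esub> g) = h f \<oplus>\<^bsub>matrix_ring 2 (residue_ring (int p))\<^esub> h g"
    proof -
      have "c' i (f (e j) \<otimes> g (e j)) = (c' i (f (e j)) + c' i (g (e j))) mod int p" if "i < 2" for i j
      proof -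
        have "f (e j) \<otimes> g (e j) =
            m (c' 0 (f (e j))) (c' 1 (f (e j))) \<otimes> m (c' 0 (g (e j))) (c' 1 (g (e j)))"
          using c(2) f g e(1) by simp
        then show ?thesis
          using that by (simp only: m_mult c'_m) (auto simp: less_2_cases_iff)
      qed
      then show ?thesis
        using e(1) by (auto intro!: eq_matI simp: h_def matrix_ring_def Z.res_add_eq)
    qed
    show "h (f \<otimes>\<^bsub>R\<^esub> g) = h f \<otimes>\<^bsub>matrix_ring 2 (residue_ring (int p))\<^esub> h g"
    proof -
      \<comment> \<open>The products are reduced modulo \<open>p\<close> separately, to match
        multiplication followed by addition in the residue ring.\<close>
      have "c' i (f (g (e j))) = (c' i (f (e 0)) * c' 0 (g (e j)) mod int p +
          c' i (f (e 1)) * c' 1 (g (e j)) mod int p) mod int p" if "i < 2" for i j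
      proof -
        have "f (g (e j)) = f (m (c' 0 (g (e j))) (c' 1 (g (e j))))"
          using c(2) g e(1) by simp
        then show ?thesis
          using that by (simp only: apply_m[OF f] c'_m) (auto simp: less_2_cases_iff mod_simps)
      qed
      then show ?thesis
        using e(1) p1 by (auto intro!: eq_matI simp: h_def matrix_ring_def Z.res_mult_eq Z_sum)
    qed
  next
    show "h \<one>\<^bsub>R\<^esub> = \<one>\<^bsub>matrix_ring 2 (residue_ring (int p))\<^esub>"
      using p1 by (intro eq_matI)
        (auto simp: h_def matrix_ring_def Z.res_one_eq Z.res_zero_eq e c'_m m_closed less_2_cases_iff)
    have "inj_on h (carrier R)"
    proof (rule inj_onI)
      fix f g assume f: "f \<in> carrier R" and g: "g \<in> carrier R" and eq: "h f = h g"
      have "c' i (f (e j)) = c' i (g (e j))" if "i < 2" "j < 2" for i j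
        using arg_cong[OF eq, of "\<lambda>A. A $$ (i, j)"] that by (simp add: h_def)
      then have "f (m i j) = g (m i j)" for i j
        unfolding apply_m[OF f] apply_m[OF g] by simp
      then show "f = g"
        using cover_ring_eqI[OF f g] c(2) by metis
    qed
    moreover have "h ` carrier R = carrier (matrix_ring 2 (residue_ring (int p)))"
    proof
      show "h ` carrier R \<subseteq> carrier (matrix_ring 2 (residue_ring (int p)))"
        using c'_range cover_ring_closed[OF _ e(1)] by (auto simp: h_def matrix_ring_def Z_carrier)
      show "carrier (matrix_ring 2 (residue_ring (int p))) \<subseteq> h ` carrier R"
      proof
        fix A assume "A \<in> carrier (matrix_ring 2 (residue_ring (int p)))"
        then have A: "A \<in> carrier_mat 2 2" "\<And>i j. i < 2 \<Longrightarrow> j < 2 \<Longrightarrow> A $$ (i, j) \<in> {0..int p - 1}"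
          unfolding matrix_ring_def Z_carrier by auto
        \<comment> \<open>The coordinates of the image of \<open>x\<close> under the linear map with
          matrix \<open>A\<close>, not yet reduced modulo \<open>p\<close>.\<close>
        define q where "q i x = A $$ (i, 0) * c' 0 x + A $$ (i, 1) * c' 1 x" for i x
        define f where "f = (\<lambda>x\<in>carrier G. m (q 0 x) (q 1 x))"
        have hom: "f (x \<otimes> y) = f x \<otimes> f y" if "x \<in> carrier G" "y \<in> carrier G" for x y
        proof -
          have "x \<otimes> y = m (c' 0 x) (c' 1 x) \<otimes> m (c' 0 y) (c' 1 y)"
            using c(2) that by simp
          then have "[c' i (x \<otimes> y) = c' i x + c' i y] (mod int p)" if "i < 2" for i
            using that by (simp only: m_mult c'_m) (auto simp: less_2_cases_iff cong_def)
          then have "[q i (x \<otimes> y) = A $$ (i, 0) * (c' 0 x + c' 0 y) + A $$ (i, 1) * (c' 1 x + c' 1 y)]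
              (mod int p)" for i
            unfolding q_def by (intro cong_add cong_scalar_left) simp_all
          then have "q i (x \<otimes> y) mod int p = (q i x + q i y) mod int p" for i
            by (simp add: q_def cong_def algebra_simps)
          then show ?thesis
            using that by (simp add: f_def m_mult) (rule m_cong, auto)
        qed
        \<comment> \<open>Cancellation in the group gives \<open>f \<one> = \<one>\<close>, which is
          what a trivial member requires.\<close>
        have "f \<one> \<in> carrier G" "f \<one> \<otimes> f \<one> = \<one> \<otimes> f \<one>"
          using hom[of \<one> \<one>] m_closed by (simp_all add: f_def)
        then have f1: "f \<one> = \<one>"
          by (simp only: right_cancel one_closed)
        have "f \<in> carrier R"
          unfolding mem_cover_ring
        proof (intro conjI ballI)
          show "f \<in> extensional (carrier G)"
            by (simp add: f_def)
          fix C x assume C: "C \<in> \<C>" "x \<in> C"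
          show "f x \<in> C"
            using triv[OF C(1)] C(2) f1 m_closed by (auto simp: f_def)
          fix y assume "y \<in> C"
          then show "f (x \<otimes> y) = f x \<otimes> f y"
            using hom C cover_mem_carrier by blast
        qed
        moreover have "h f = A"
        proof (rule eq_matI)
          show "dim_row (h f) = dim_row A" "dim_col (h f) = dim_col A"
            using A by (auto simp: h_def)
          fix i j assume "i < dim_row A" "j < dim_col A"
          then have ij: "i < 2" "j < 2"
            using A by auto
          have "c' i (f (e j)) = q i (e j) mod int p"
            using ij e(1) by (auto simp: f_def c'_m less_2_cases_iff)
          also have "\<dots> = A $$ (i, j)"
            using ij A(2)[OF ij] p1 by (auto simp: q_def e(2) c'_m less_2_cases_iff)
          finally show "h f $$ (i, j) = A $$ (i, j)"
            using ij by (simp add: h_def)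
        qed
        ultimately show "A \<in> h ` carrier R"
          by blast
      qed
    qed
    ultimately show "bij_betw h (carrier R) (carrier (matrix_ring 2 (residue_ring (int p))))"
      by (simp add: bij_betw_def)
  qed
  then show ?thesis
    by (auto simp: is_ring_iso_def)
qed

end

section \<open>Simple rings of star coverings\<close>

locale simple_star_covered_group = star_covered_group +
  assumes p_group: "\<exists>n. order G = p ^ n"
    and simple: "simple_ring (cover_ring G \<C>)"
begin

sublocale R: simple_ring R
  by (fact simple)

lemma ideal_eq_carrier: "ideal I R \<Longrightarrow> f \<in> I \<Longrightarrow> f \<noteq> \<zero>\<^bsub>R\<^esub> \<Longrightarrow> I = carrier R"
  using R.ideal_trivial by blast

text \<open>On a trivial group the zero function is the only element of \<open>R\<close>, while a
  simple ring is nonzero.\<close>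

lemma ex_non_one: "\<exists>x\<in>carrier G. x \<noteq> \<one>"
proof (rule ccontr)
  assume "\<not> ?thesis"
  then have "f = \<zero>\<^bsub>R\<^esub>" if "f \<in> carrier R" for f
    using that cover_ring_closed[OF that] by (intro cover_ring_eqI[OF that R.zero_closed]) auto
  then show False
    using R.not_zero_ring R.zero_closed by blast
qed

section \<open>Simplicity forces exponent p\<close>

lemma exponent_p:
  assumes "x \<in> carrier G" shows "x [^] p = \<one>"
proof -
  \<comment> \<open>The exponent of \<open>G\<close> is \<open>p ^ m\<close>; such an
    \<open>m\<close> exists because the order of \<open>G\<close> is a power of
    \<open>p\<close>.\<close>
  define m where "m = (LEAST m. \<forall>x\<in>carrier G. x [^] (p ^ m) = \<one>)"
  obtain n where "order G = p ^ n"
    using p_group by blast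
  then have "\<forall>x\<in>carrier G. x [^] (p ^ n) = \<one>"
    using pow_order_eq_1 by auto
  then have "\<exists>m. \<forall>x\<in>carrier G. x [^] (p ^ m) = \<one>"
    by blast
  then have m: "\<forall>x\<in>carrier G. x [^] (p ^ m) = \<one>"
    unfolding m_def by (rule LeastI_ex)
  have "m \<noteq> 0"
  proof
    assume "m = 0"
    then show False
      using m ex_non_one by simp
  qed
  then obtain k where k: "m = Suc k"
    using not0_implies_Suc by blast
  \<comment> \<open>By minimality of \<open>m\<close>, the power map with exponent
    \<open>p ^ k\<close> is not the zero of \<open>R\<close>; \<open>y\<close> witnesses
    this.\<close>
  have "\<not> (\<forall>x\<in>carrier G. x [^] (p ^ k) = \<one>)"
    using not_less_Least[of k "\<lambda>m. \<forall>x\<in>carrier G. x [^] (p ^ m) = \<one>"] k unfolding m_def by simp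
  then obtain y where y: "y \<in> carrier G" "y [^] (p ^ k) \<noteq> \<one>"
    by blast
  define I where "I = {f \<in> carrier R. \<forall>x\<in>carrier G. f x [^] p = \<one>}"
  have "ideal I R"
  proof (rule R.idealI_closed)
    fix f g assume f: "f \<in> I" and g: "g \<in> I"
    \<comment> \<open>The values \<open>f x\<close> and \<open>g x\<close> lie in one abelian member
      with \<open>x\<close>, so the power distributes over their product.\<close>
    have "(f x \<otimes> g x) [^] p = \<one>" if x: "x \<in> carrier G" for x
    proof -
      obtain C where C: "C \<in> \<C>" "x \<in> C"
        using x cover_obtain by blast
      then have "f x \<otimes> g x = g x \<otimes> f x"
        using f g comm_cover by (auto simp: I_def mem_cover_ring)
      then show ?thesis
        using x f g pow_mult_distrib[of "f x" "g x" p] by (simp add: I_def)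
    qed
    then show "f \<oplus>\<^bsub>R\<^esub> g \<in> I"
      using f g by (simp add: I_def)
    fix h assume h: "h \<in> carrier R"
    have "h (f x) [^] p = \<one>" if "x \<in> carrier G" for x
      using that f h cover_ring_nat_pow[OF h, of "f x" p] by (simp add: I_def)
    then show "h \<otimes>\<^bsub>R\<^esub> f \<in> I"
      using f h by (simp add: I_def)
    show "f \<otimes>\<^bsub>R\<^esub> h \<in> I"
      using f h by (simp add: I_def)
  qed (auto simp: I_def)
  moreover have "(\<lambda>x\<in>carrier G. x [^] (p ^ k)) \<in> I"
    using int_pow_mem_cover_ring[of "int (p ^ k)"] m unfolding k int_pow_int
    by (simp add: I_def nat_pow_pow mult.commute)
  moreover have "(\<lambda>x\<in>carrier G. x [^] (p ^ k)) \<noteq> \<zero>\<^bsub>R\<^esub>"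
  proof
    assume "(\<lambda>x\<in>carrier G. x [^] (p ^ k)) = \<zero>\<^bsub>R\<^esub>"
    then have "(\<lambda>x\<in>carrier G. x [^] (p ^ k)) y = \<zero>\<^bsub>R\<^esub> y"
      by (rule arg_cong)
    then show False
      using y by simp
  qed
  ultimately have "I = carrier R"
    by (rule ideal_eq_carrier)
  then have "\<one>\<^bsub>R\<^esub> \<in> I"
    by simp
  then show ?thesis
    using assms by (simp add: I_def)
qed

lemma int_pow_eq_mod:
  "x \<in> carrier G \<Longrightarrow> x \<noteq> \<one> \<Longrightarrow> x [^] (i::int) = x [^] j \<longleftrightarrow> i mod int p = j mod int p"
  using int_pow_eq_iff_cong[OF prime] exponent_p by (simp add: cong_def)

section \<open>A common eigenvector gives the prime field\<close>

text \<open>The element \<open>x\<close> is a common eigenvector, and \<open>\<phi> f\<close> is the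
  eigenvalue of \<open>f\<close>. The power maps realise every eigenvalue.\<close>

lemma iso_residue_ring:
  assumes x: "x \<in> carrier G" "x \<noteq> \<one>"
    and eigen: "\<And>f. f \<in> carrier R \<Longrightarrow> \<exists>k::int. f x = x [^] k"
  shows "R \<simeq> residue_ring (int p)"
proof -
  have p1: "int p > 1"
    using prime prime_gt_1_nat by simp
  \<comment> \<open>The chosen exponent is unique only modulo \<open>p\<close>; reducing it makes
    \<open>\<phi> f\<close> independent of the choice.\<close>
  define \<phi> where "\<phi> f = (SOME k. f x = x [^] k) mod int p" for f
  have \<phi>: "f x = x [^] \<phi> f" if "f \<in> carrier R" for f
    using someI_ex[OF eigen[OF that]] x by (simp add: \<phi>_def int_pow_mod exponent_p)
  have \<phi>_eq: "\<phi> f = k mod int p" if "f \<in> carrier R" "f x = x [^] k" for f k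
  proof -
    have "\<phi> f mod int p = k mod int p"
      using int_pow_eq_mod[OF x] \<phi>[OF that(1)] that(2) by simp
    then show ?thesis
      by (simp add: \<phi>_def)
  qed
  have "\<phi> \<in> ring_iso R (residue_ring (int p))"
  proof (rule ring_iso_memI)
    fix f assume f: "f \<in> carrier R"
    show "\<phi> f \<in> carrier (residue_ring (int p))"
      using p1 by (simp add: \<phi>_def residue_ring_def)
    fix g assume g: "g \<in> carrier R"
    show "\<phi> (f \<otimes>\<^bsub>R\<^esub> g) = \<phi> f \<otimes>\<^bsub>residue_ring (int p)\<^esub> \<phi> g"
    proof -
      have "f (g x) = x [^] (\<phi> f * \<phi> g)"
        using x \<phi>[OF g] \<phi>[OF f] cover_ring_int_pow[OF f x(1)] by (simp add: int_pow_pow)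
      then show ?thesis
        using f g x by (simp add: \<phi>_eq residue_ring_def)
    qed
    show "\<phi> (f \<oplus>\<^bsub>R\<^esub> g) = \<phi> f \<oplus>\<^bsub>residue_ring (int p)\<^esub> \<phi> g"
    proof -
      have "f x \<otimes> g x = x [^] (\<phi> f + \<phi> g)"
        using x \<phi>[OF g] \<phi>[OF f] by (simp add: int_pow_mult)
      then show ?thesis
        using f g x by (simp add: \<phi>_eq residue_ring_def)
    qed
  next
    show "\<phi> \<one>\<^bsub>R\<^esub> = \<one>\<^bsub>residue_ring (int p)\<^esub>"
      using \<phi>_eq[OF R.one_closed, of 1] x p1 by (simp add: residue_ring_def)
    \<comment> \<open>This is the kernel of \<open>\<phi>\<close>. It omits the identity, so it is
      zero by simplicity.\<close>
    define I where "I = {f \<in> carrier R. f x = \<one>}"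
    have "ideal I R"
    proof (rule R.idealI_closed)
      fix f g assume f: "f \<in> I" and g: "g \<in> carrier R"
      have "f (g x) = f x [^] \<phi> g"
        using f g x \<phi>[OF g] cover_ring_int_pow[of f x "\<phi> g"] by (simp add: I_def)
      then show "f \<otimes>\<^bsub>R\<^esub> g \<in> I"
        using f g x by (simp add: I_def)
    qed (use x in \<open>auto simp: I_def\<close>)
    moreover have "I \<noteq> carrier R"
    proof
      assume "I = carrier R"
      then have "\<one>\<^bsub>R\<^esub> \<in> I"
        by simp
      then show False
        using x by (simp add: I_def)
    qed
    ultimately have "I = {\<zero>\<^bsub>R\<^esub>}"
      using R.ideal_trivial by blast
    then have I: "f = \<zero>\<^bsub>R\<^esub>" if "f \<in> carrier R" "f x = \<one>" for f
      using that unfolding I_def by blast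
    have "inj_on \<phi> (carrier R)"
    proof (rule inj_onI)
      fix f g assume f: "f \<in> carrier R" and g: "g \<in> carrier R" and eq: "\<phi> f = \<phi> g"
      \<comment> \<open>The difference is evaluated at \<open>x\<close> by adding \<open>g\<close>
        back and cancelling \<open>g x\<close>.\<close>
      have "(f \<ominus>\<^bsub>R\<^esub> g) x \<otimes> g x = (f \<ominus>\<^bsub>R\<^esub> g \<oplus>\<^bsub>R\<^esub> g) x"
        using x by simp
      also have "\<dots> = g x"
        using f g eq \<phi>[OF f] \<phi>[OF g] by (simp add: R.minus_eq R.a_assoc R.l_neg)
      finally have "(f \<ominus>\<^bsub>R\<^esub> g) x = \<one>"
        using f g x right_cancel[of "g x" "(f \<ominus>\<^bsub>R\<^esub> g) x" \<one>] by simp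
      then have "f \<ominus>\<^bsub>R\<^esub> g = \<zero>\<^bsub>R\<^esub>"
        using I f g by simp
      then show "f = g"
        using f g by (simp add: R.r_right_minus_eq)
    qed
    moreover have "\<phi> ` carrier R = carrier (residue_ring (int p))"
    proof
      show "\<phi> ` carrier R \<subseteq> carrier (residue_ring (int p))"
        using p1 by (auto simp: \<phi>_def residue_ring_def)
      show "carrier (residue_ring (int p)) \<subseteq> \<phi> ` carrier R"
      proof
        fix k assume "k \<in> carrier (residue_ring (int p))"
        then have "\<phi> (\<lambda>x\<in>carrier G. x [^] k) = k"
          using \<phi>_eq[OF int_pow_mem_cover_ring, of k k] x by (simp add: residue_ring_def)
        then show "k \<in> \<phi> ` carrier R"
          using int_pow_mem_cover_ring[of k] by force
      qed
    qed
    ultimately show "bij_betw \<phi> (carrier R) (carrier (residue_ring (int p)))"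
      by (simp add: bij_betw_def)
  qed
  then show ?thesis
    by (auto simp: is_ring_iso_def)
qed

section \<open>Eigenvectors in the members of the cover\<close>

text \<open>Since \<open>G\<close> has exponent \<open>p\<close>, every nontrivial \<open>x\<close>
  in the cyclic group \<open>C\<close> generates it, and \<open>f x\<close> stays in
  \<open>C\<close>.\<close>

lemma maximal_cyclic_eigen:
  assumes C: "C \<in> \<C>" "maximal_cyclic_subgroup C G" and x: "x \<in> C" "x \<noteq> \<one>" and f: "f \<in> carrier R"
  shows "\<exists>k::int. f x = x [^] k"
proof -
  interpret C: group "G\<lparr>carrier := C\<rparr>"
    using subgroup.subgroup_is_group[OF subgroup_cover[OF C(1)] is_group] .
  have "\<exists>c\<in>C. C = range (\<lambda>n::int. c [^]\<^bsub>G\<lparr>carrier := C\<rparr>\<^esub> n)"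
    using C(2) C.cyclic_group unfolding maximal_cyclic_subgroup_def cyclic_subgroup_def by simp
  then obtain c where cC: "c \<in> C" and "C = range (\<lambda>n::int. c [^]\<^bsub>G\<lparr>carrier := C\<rparr>\<^esub> n)"
    by blast
  then have c: "C = range (\<lambda>n::int. c [^] n)"
    unfolding int_pow_consistent[OF subgroup_cover[OF C(1)] cC] by iprover
  have car: "c \<in> carrier G"
    using cover_mem_carrier[OF C(1) cC] .
  obtain i :: int where i: "x = c [^] i"
    using x c by blast
  have "f x \<in> C"
    using f C x by (simp add: mem_cover_ring)
  then obtain j :: int where j: "f x = c [^] j"
    using c by blast
  have "\<not> int p dvd i"
  proof
    assume "int p dvd i"
    then have "c [^] i = c [^] (0::int)"
      using int_pow_mod[OF car exponent_p[OF car], of i] by simp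
    then show False
      using i x by simp
  qed
  then obtain u :: int where "c = (c [^] i) [^] u"
    using mem_range_int_pow[OF prime car exponent_p[OF car]] by blast
  then have "f x = x [^] (u * j)"
    using i j car int_pow_pow[of "c [^] i" u j] by simp
  then show ?thesis
    by blast
qed

lemma iso_matrix_ring_if_no_eigen:
  assumes no_eigen: "\<And>x. x \<in> carrier G \<Longrightarrow> x \<noteq> \<one> \<Longrightarrow> \<exists>f\<in>carrier R. \<forall>k::int. f x \<noteq> x [^] k"
  shows "R \<simeq> matrix_ring 2 (residue_ring (int p))"
proof -
  \<comment> \<open>A cyclic member with a nontrivial element would provide a common
    eigenvector.\<close>
  have card: "card C = p ^ 2" if "C \<in> \<C>" "x \<in> C" "x \<noteq> \<one>" for C x
  proof -
    have "\<not> maximal_cyclic_subgroup C G"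
      using maximal_cyclic_eigen[OF that(1) _ that(2,3)] no_eigen[OF cover_mem_carrier that(3)] that
      by blast
    then show ?thesis
      using star that(1) unfolding star_covering_def by blast
  qed
  \<comment> \<open>Some \<open>f\<close> moves \<open>x\<close> off its own powers. Then
    \<open>x\<close> and \<open>f x\<close> form a basis of \<open>C\<close>, and both lie in
    \<open>D\<close>.\<close>
  have sub: "C \<subseteq> D" if C: "C \<in> \<C>" "x \<in> C" and D: "D \<in> \<C>" "x \<in> D" and x: "x \<noteq> \<one>" for C D x
  proof -
    obtain f where f: "f \<in> carrier R" "\<And>k::int. f x \<noteq> x [^] k"
      using no_eigen[OF cover_mem_carrier[OF C] x] by blast
    have fx: "f x \<in> C" "f x \<in> D"
      using f(1) C D by (auto simp: mem_cover_ring)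
    have "bij_betw (\<lambda>(i, j). x [^] i \<otimes> f x [^] j) ({0..int p - 1} \<times> {0..int p - 1}) C"
      using bij_betw_basis[OF prime subgroup_cover[OF C(1)] _ card[OF C x] C(2) x fx(1) f(2)]
        exponent_p cover_mem_carrier[OF C(1)] by blast
    then have "C = (\<lambda>(i, j). x [^] i \<otimes> f x [^] j) ` ({0..int p - 1} \<times> {0..int p - 1})"
      by (simp add: bij_betw_def)
    also have "\<dots> \<subseteq> D"
      using subgroup_int_pow_closed[OF subgroup_cover[OF D(1)]] D(2) fx(2)
        subgroup.m_closed[OF subgroup_cover[OF D(1)]] by auto
    finally show ?thesis .
  qed
  have inter: "x = \<one>" if "C \<in> \<C>" "D \<in> \<C>" "x \<in> C" "x \<in> D" "C \<noteq> D" for C D x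
    using sub[of C x D] sub[of D x C] that by blast
  obtain x0 where x0: "x0 \<in> carrier G" "x0 \<noteq> \<one>"
    using ex_non_one by blast
  obtain C0 where C0: "C0 \<in> \<C>" "x0 \<in> C0"
    using cover_obtain[OF x0(1)] by blast
  \<comment> \<open>The projection onto \<open>C0\<close> is a homomorphism on each member: it is
    the identity on \<open>C0\<close> and trivial on every other member, by
    \<open>inter\<close>.\<close>
  define e where "e = (\<lambda>y\<in>carrier G. if y \<in> C0 then y else \<one>)"
  have e_off: "e y = \<one>" if "C \<in> \<C>" "C \<noteq> C0" "y \<in> C" for C y
    using inter[OF that(1) C0(1) that(3)] that cover_mem_carrier[OF that(1,3)] by (auto simp: e_def)
  have e_on: "e y = y" if "y \<in> C0" for y
    using that cover_mem_carrier[OF C0(1)] by (simp add: e_def)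
  have e: "e \<in> carrier R"
    unfolding mem_cover_ring
  proof (intro conjI ballI)
    show "e \<in> extensional (carrier G)"
      by (simp add: e_def)
    fix C x assume C: "C \<in> \<C>" and x: "x \<in> C"
    show "e x \<in> C"
      using e_off[OF C _ x] e_on x subgroup.one_closed[OF subgroup_cover[OF C]]
      by (cases "C = C0") auto
    fix y assume y: "y \<in> C"
    have "x \<otimes> y \<in> C"
      using subgroup.m_closed[OF subgroup_cover[OF C] x y] .
    then show "e (x \<otimes> y) = e x \<otimes> e y"
      using e_off[OF C] e_on x y by (cases "C = C0") auto
  qed
  define I where "I = {f \<in> carrier R. \<forall>y\<in>carrier G - C0. f y = \<one>}"
  have "ideal I R"
  proof (rule R.idealI_closed)
    fix f g assume f: "f \<in> I" and g: "g \<in> carrier R"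
    have fR: "f \<in> carrier R"
      using f by (simp add: I_def)
    show "g \<otimes>\<^bsub>R\<^esub> f \<in> I"
      using f g by (simp add: I_def)
    \<comment> \<open>The function \<open>g\<close> keeps \<open>y\<close> inside a member other
      than \<open>C0\<close>, which meets \<open>C0\<close> only in \<open>\<one>\<close>;
      \<open>f\<close> is trivial there in either case.\<close>
    have "f (g y) = \<one>" if y: "y \<in> carrier G" "y \<notin> C0" for y
    proof -
      obtain C where C: "C \<in> \<C>" "y \<in> C"
        using cover_obtain[OF y(1)] by blast
      have gy: "g y \<in> C"
        using C g by (simp add: mem_cover_ring)
      show ?thesis
      proof (cases "g y \<in> C0")
        case True
        then have "g y = \<one>"
          using inter[OF C(1) C0(1) gy] C(2) y(2) by blast
        then show ?thesis
          using fR by simp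
      next
        case False
        then show ?thesis
          using f cover_mem_carrier[OF C(1) gy] by (simp add: I_def)
      qed
    qed
    then show "f \<otimes>\<^bsub>R\<^esub> g \<in> I"
      using fR g by (simp add: I_def)
  qed (auto simp: I_def)
  moreover have "e \<in> I"
    using e by (simp add: I_def) (simp add: e_def)
  moreover have "e \<noteq> \<zero>\<^bsub>R\<^esub>"
    using e_on[OF C0(2)] x0 by (metis cover_ring_ops(4))
  ultimately have "I = carrier R"
    by (rule ideal_eq_carrier)
  \<comment> \<open>The identity is trivial outside \<open>C0\<close> only if nothing nontrivial
    lies outside \<open>C0\<close>.\<close>
  then have "\<one>\<^bsub>R\<^esub> \<in> I"
    by simp
  then have "y \<in> C0 \<or> y = \<one>" if "y \<in> carrier G" for y
    using that by (auto simp: I_def)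
  then have G: "C0 = carrier G"
    using cover_mem_carrier[OF C0(1)] subgroup.one_closed[OF subgroup_cover[OF C0(1)]] by auto
  show ?thesis
  proof (rule iso_matrix_ring)
    show "order G = p ^ 2"
      using card[OF C0 x0(2)] G by (simp add: order_def)
    show "carrier G \<in> \<C>"
      using C0(1) G by simp
    show "C = carrier G \<or> C = {\<one>}" if C: "C \<in> \<C>" for C
    proof (cases "C = carrier G")
      case False
      then have "x = \<one>" if "x \<in> C" for x
        using inter[OF C C0(1) that] cover_mem_carrier[OF C that] G by simp
      then show ?thesis
        using subgroup.one_closed[OF subgroup_cover[OF C]] by blast
    qed simp
  qed (rule exponent_p)
qed

end

theorem mainTheorem2:
  fixes p :: nat and G :: "'a monoid" and \<C> :: "'a set set"
  assumes "Factorial_Ring.prime p"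
    and "group G" and "finite (carrier G)" and "\<exists>n. order G = p ^ n"
    and "star_covering p G \<C>"
    and "simple_ring (cover_ring G \<C>)"
  shows "cover_ring G \<C> \<simeq> residue_ring (int p) \<or>
         cover_ring G \<C> \<simeq> matrix_ring 2 (residue_ring (int p))"
proof -
  interpret simple_star_covered_group G p \<C>
    using assms by (intro simple_star_covered_group.intro star_covered_group.intro
        star_covered_group_axioms.intro simple_star_covered_group_axioms.intro)
  \<comment> \<open>The alternatives are that some nontrivial element is a common eigenvector or
    that none is.\<close>
  show ?thesis
    using iso_residue_ring iso_matrix_ring_if_no_eigen by blast
qed

end
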